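(* $$-\frac{14\zeta(3)}{\pi^2}+4\log 2=1+\sum_{n=1}^\infty\frac{4n+1}{(2n)(2n+1)}\binom{2n}{n}^4\frac{1}{2^{8n}}.$$ *)

theory Defs
  imports "HOL-Analysis.Analysis"
begin

(* The Riemann zeta function as its Dirichlet series; meaningful only for real s > 1,
   where the series converges (zeta_real_sums). *)
definition zeta_real :: "real \<Rightarrow> real" where
  "zeta_real s = (\<Sum>k. 1 / real (Suc k) powr s)"

lemma zeta_real_sums:
  assumes "s > 1"
  shows "(\<lambda>k. 1 / real (Suc k) powr s) sums zeta_real s"
proof -
  have "summable (\<lambda>k. real k powr (- s))"
    using assms by (simp add: summable_real_powr_iff)
  then have "summable (\<lambda>k. real (Suc k) powr (- s))"
    by (subst summable_Suc_iff)
  then show ?thesis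
    unfolding zeta_real_def by (simp add: powr_minus_divide summable_sums)
qed

definition series_term :: "nat \<Rightarrow> real" where
  "series_term n =
     (4 * real n + 1) / ((2 * real n) * (2 * real n + 1)) * real ((2 * n) choose n) ^ 4 * (1 / 2 ^ (8 * n))"

end

theory Submission
  imports Defs
begin

text \<open>
  Let \<open>b\<^sub>n\<close> be the central binomial coefficient divided by \<open>4\<^sup>n\<close>. The Legendre coefficients of
  \<open>1 / sqrt (1 - x\<^sup>2)\<close> are \<open>\<pi>/2 (4n+1) b\<^sub>n\<^sup>2\<close> at even degree \<open>2n\<close>, and \<open>2n(2n+1)\<close> is the corresponding
  eigenvalue of the Legendre operator, so by Parseval the series is the integral of
  \<open>(cos s - 1 + 2s/\<pi>)\<^sup>2 / sin s\<close> over \<open>[0, \<pi>/2]\<close>. No Legendre polynomials are needed for this: one factor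
  \<open>b\<^sub>n\<^sup>2\<close> is expanded into moments of monomials through the power series of \<open>1 / sqrt (1 - x\<^sup>2)\<close>, the
  summations are exchanged, and the inner finite sums telescope. The integral is then evaluated with
  \<open>1 / sin s = 2 (sin s + sin 3s + sin 5s + ...)\<close>; the cubic reciprocals of the odd numbers give
  \<open>\<zeta>(3)\<close>, and Catalan's constant cancels.
\<close>

section \<open>Legendre moments and telescoping sums\<close>

definition cbin :: "nat \<Rightarrow> real" where
  "cbin n = real ((2 * n) choose n) / 4 ^ n"

lemma cbin_0 [simp]: "cbin 0 = 1"
  by (simp add: cbin_def)

lemma cbin_Suc: "cbin (Suc n) = cbin n * (2 * real n + 1) / (2 * real n + 2)"
proof -
  have c: "real ((2 * n) choose n) = fact (2 * n) / (fact n)\<^sup>2" for n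
    by (simp add: binomial_fact power2_eq_square)
  have "fact (2 * Suc n) = (2 * real n + 2) * (2 * real n + 1) * fact (2 * n)"
    by (simp add: algebra_simps)
  moreover have "fact (Suc n) = (real n + 1) * fact n"
    by simp
  moreover have "(0::real) < fact n" "real n + 1 > 0"
    by simp_all
  ultimately show ?thesis
    unfolding cbin_def c by (simp add: divide_simps del: fact_Suc) (simp add: power2_eq_square algebra_simps)
qed

lemma cbin_pos: "cbin n > 0"
  by (simp add: cbin_def)

text \<open>Consecutive values have the ratio (2n+1)(2n+3)/(2n+2)^2 < 1, so the product decreases
  from its value 1 at n = 0. It serves to show that \<open>cbin\<close> tends to 0.\<close>

lemma cbin_square_le: "(cbin n)\<^sup>2 * (2 * real n + 1) \<le> 1"
proof (induction n)
  case (Suc n)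
  have "(cbin (Suc n))\<^sup>2 * (2 * real (Suc n) + 1)
      = ((cbin n)\<^sup>2 * (2 * real n + 1)) * ((2 * real n + 1) * (2 * real n + 3) / (2 * real n + 2)\<^sup>2)"
    by (simp add: cbin_Suc power_divide power_mult_distrib) (simp add: power2_eq_square algebra_simps)
  also have "\<dots> \<le> 1 * 1"
  proof (rule mult_mono[OF Suc.IH])
    have "(2 * real n + 1) * (2 * real n + 3) \<le> (2 * real n + 2)\<^sup>2"
      by (simp add: power2_eq_square algebra_simps)
    then show "(2 * real n + 1) * (2 * real n + 3) / (2 * real n + 2)\<^sup>2 \<le> 1"
      by (simp add: divide_le_eq_1)
  qed simp_all
  finally show ?case by simp
qed simp

lemma cbin_tendsto_0: "cbin \<longlonglongrightarrow> 0"
proof -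
  have "(\<lambda>n. (cbin n)\<^sup>2) \<longlonglongrightarrow> 0"
  proof (rule tendsto_sandwich[OF _ _ tendsto_const])
    show "(\<lambda>n. 1 / real (Suc n)) \<longlonglongrightarrow> 0"
      by (rule lim_1_over_n[THEN LIMSEQ_Suc])
    have "(cbin n)\<^sup>2 \<le> 1 / real (Suc n)" for n
    proof -
      have "(cbin n)\<^sup>2 * real (Suc n) \<le> (cbin n)\<^sup>2 * (2 * real n + 1)"
        by (intro mult_left_mono) auto
      with cbin_square_le[of n] show ?thesis by (simp add: pos_le_divide_eq del: of_nat_Suc)
    qed
    then show "\<forall>\<^sub>F n in sequentially. (cbin n)\<^sup>2 \<le> 1 / real (Suc n)" by simp
  qed simp
  then show ?thesis by (simp add: power_tendsto_0_iff)
qed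

text \<open>The Legendre moment \<open>\<integral>\<^bsub>-1\<^esub>\<^bsup>1\<^esup> x\<^bsup>2j\<^esup> P\<^bsub>2n\<^esub>(x) dx\<close>.\<close>

definition leg_moment :: "nat \<Rightarrow> nat \<Rightarrow> real" where
  "leg_moment j n =
     2 * (\<Prod>i<n. 2 * real j - 2 * real i) / (\<Prod>i\<le>n. 2 * real j + 2 * real i + 1)"

lemma leg_moment_0: "leg_moment j 0 = 2 / (2 * real j + 1)"
  by (simp add: leg_moment_def)

text \<open>One new factor enters each product. The division-free form also covers j = n, where the
  new factor is 0.\<close>

lemma leg_moment_Suc_right:
  "leg_moment j (Suc n) * (2 * real j + 2 * real n + 3) = leg_moment j n * (2 * real j - 2 * real n)"
proof -
  define p q d where "p = (\<Prod>i<n. 2 * real j - 2 * real i)"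
    and "q = (\<Prod>i\<le>n. 2 * real j + 2 * real i + 1)" and "d = 2 * real j + 2 * real n + 3"
  have d: "d \<noteq> 0" by (simp add: d_def add_eq_0_iff)
  have "(\<Prod>i\<le>Suc n. 2 * real j + 2 * real i + 1) = q * d"
    by (simp add: q_def d_def add_ac)
  then have "leg_moment j (Suc n) = 2 * (p * (2 * real j - 2 * real n)) / (q * d)"
    unfolding leg_moment_def p_def by simp
  moreover have "leg_moment j n = 2 * p / q"
    unfolding leg_moment_def p_def q_def ..
  ultimately show ?thesis
    using d unfolding d_def[symmetric] by simp
qed

text \<open>Raising j by 1 shifts both products by one index, so only their end factors change. The
  induction on n uses the recurrence in n for both j and j+1.\<close>

lemma leg_moment_Suc_left:
  "leg_moment (Suc j) n * (2 * real j + 2 - 2 * real n) * (2 * real j + 2 * real n + 3)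
     = leg_moment j n * (2 * real j + 2) * (2 * real j + 1)"
proof (induction n)
  case 0
  then show ?case by (simp add: leg_moment_0 field_simps)
next
  case (Suc n)
  define x y where "x = 2 * real j" and "y = 2 * real n"
  have r: "leg_moment j (Suc n) * (x + y + 3) = leg_moment j n * (x - y)"
          "leg_moment (Suc j) (Suc n) * (x + y + 5) = leg_moment (Suc j) n * (x + 2 - y)"
    using leg_moment_Suc_right[of j n] leg_moment_Suc_right[of "Suc j" n]
    by (simp_all add: x_def y_def algebra_simps)
  have IH: "leg_moment (Suc j) n * (x + 2 - y) * (x + y + 3) = leg_moment j n * (x + 2) * (x + 1)"
    using Suc.IH by (simp add: x_def y_def algebra_simps)
  have pos: "x + y + 3 > 0" by (simp add: x_def y_def)
  have "(leg_moment (Suc j) (Suc n) * (x - y) * (x + y + 5)) * (x + y + 3)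
      = (leg_moment j (Suc n) * (x + 2) * (x + 1)) * (x + y + 3)"
    using r IH by algebra
  with pos have "leg_moment (Suc j) (Suc n) * (x - y) * (x + y + 5) = leg_moment j (Suc n) * (x + 2) * (x + 1)"
    by simp
  then show ?case by (simp add: x_def y_def algebra_simps)
qed

text \<open>The factor i = j vanishes; this is the orthogonality of a Legendre polynomial to
  monomials of lower degree. It makes the sums over n finite.\<close>

lemma leg_moment_eq_0: "j < n \<Longrightarrow> leg_moment j n = 0"
  by (auto simp: leg_moment_def)

lemma leg_moment_nonneg: "leg_moment j n \<ge> 0"
proof (cases "j < n")
  case False
  then show ?thesis
    unfolding leg_moment_def
    by (intro divide_nonneg_nonneg mult_nonneg_nonneg prod_nonneg) auto
qed (simp add: leg_moment_eq_0)

text \<open>The moments decrease in n, starting from 2/(2j+1). The bound controls the boundary term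
  of a telescoping series below.\<close>

lemma leg_moment_le: "leg_moment j n * (2 * real j + 1) \<le> 2"
proof (induction n)
  case 0
  then show ?case by (simp add: leg_moment_0 divide_le_eq)
next
  case (Suc n)
  have "leg_moment j (Suc n) \<le> leg_moment j n"
  proof (cases "j \<le> n")
    case True
    then show ?thesis by (simp add: leg_moment_eq_0 leg_moment_nonneg)
  next
    case False
    have "leg_moment j (Suc n) * (2 * real j + 2 * real n + 3)
        \<le> leg_moment j n * (2 * real j + 2 * real n + 3)"
      unfolding leg_moment_Suc_right by (intro mult_left_mono leg_moment_nonneg) auto
    then show ?thesis
      by (rule mult_right_le_imp_le) auto
  qed
  then have "leg_moment j (Suc n) * (2 * real j + 1) \<le> leg_moment j n * (2 * real j + 1)"
    by (intro mult_right_mono) auto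
  with Suc.IH show ?case by linarith
qed

text \<open>Formally, the Legendre expansion of 1/sqrt(1-x^2) is integrated against x^(2j), which
  gives pi times \<open>cbin j\<close>. The proof telescopes a combination of the summands for j+1
  and j, so that the sum obeys the recurrence of \<open>cbin\<close>.\<close>

lemma leg_moment_sum: "(\<Sum>n\<le>j. (4 * real n + 1) * (cbin n)\<^sup>2 * leg_moment j n) = 2 * cbin j"
proof (induction j)
  case 0
  then show ?case by (simp add: leg_moment_0)
next
  case (Suc j)
  \<comment> \<open>The telescoping certificate: its factor (2n)^2 kills the lower end n = 0, and
    the moment kills the upper end n = j+2.\<close>
  define G where "G n = (2 * real n)\<^sup>2 * (cbin n)\<^sup>2 * leg_moment (Suc j) n * (2 * real j + 2 * real n + 3)" for n
  have step: "(4 * real n + 1) * (cbin n)\<^sup>2 *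
      ((2 * real j + 2)\<^sup>2 * leg_moment (Suc j) n - (2 * real j + 2) * (2 * real j + 1) * leg_moment j n)
      = G n - G (Suc n)" for n
  proof -
    define x y where "x = 2 * real j" and "y = 2 * real n"
    have r: "leg_moment (Suc j) (Suc n) * (x + y + 5) = leg_moment (Suc j) n * (x + 2 - y)"
            "leg_moment (Suc j) n * (x + 2 - y) * (x + y + 3) = leg_moment j n * (x + 2) * (x + 1)"
      using leg_moment_Suc_right[of "Suc j" n] leg_moment_Suc_left[of j n]
      by (simp_all add: x_def y_def algebra_simps)
    have b: "cbin (Suc n) * (y + 2) = cbin n * (y + 1)"
      by (simp add: cbin_Suc y_def add_eq_0_iff)
    have "G (Suc n) = (y + 2)\<^sup>2 * (cbin (Suc n))\<^sup>2 * leg_moment (Suc j) (Suc n) * (x + y + 5)"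
      by (simp add: G_def x_def y_def algebra_simps)
    also have "\<dots> = (cbin (Suc n) * (y + 2))\<^sup>2 * (leg_moment (Suc j) (Suc n) * (x + y + 5))"
      by (simp add: power_mult_distrib)
    also have "\<dots> = (cbin n * (y + 1))\<^sup>2 * (leg_moment (Suc j) n * (x + 2 - y))"
      by (simp only: b r)
    finally have G: "G (Suc n) = (cbin n)\<^sup>2 * (y + 1)\<^sup>2 * leg_moment (Suc j) n * (x + 2 - y)"
      by (simp add: power_mult_distrib)
    have G': "G n = y\<^sup>2 * (cbin n)\<^sup>2 * leg_moment (Suc j) n * (x + y + 3)"
      by (simp add: G_def x_def y_def)
    have e: "(x + 2) * (x + 1) * leg_moment j n = leg_moment (Suc j) n * (x + 2 - y) * (x + y + 3)"
      using r(2) by (simp add: mult_ac)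
    have "(2 * y + 1) * (cbin n)\<^sup>2 *
      ((x + 2)\<^sup>2 * leg_moment (Suc j) n - (x + 2) * (x + 1) * leg_moment j n) = G n - G (Suc n)"
      unfolding G G' e by algebra
    then show ?thesis by (simp add: x_def y_def)
  qed
  have "(\<Sum>n\<le>Suc j. G n - G (Suc n)) = G 0 - G (Suc (Suc j))"
    by (rule sum_telescope)
  also have "\<dots> = 0" by (simp add: G_def leg_moment_eq_0)
  finally have "(\<Sum>n\<le>Suc j. (4 * real n + 1) * (cbin n)\<^sup>2 *
      ((2 * real j + 2)\<^sup>2 * leg_moment (Suc j) n - (2 * real j + 2) * (2 * real j + 1) * leg_moment j n)) = 0"
    by (simp only: step)
  then have "(2 * real j + 2)\<^sup>2 * (\<Sum>n\<le>Suc j. (4 * real n + 1) * (cbin n)\<^sup>2 * leg_moment (Suc j) n)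
     = (2 * real j + 2) * (2 * real j + 1) * (\<Sum>n\<le>Suc j. (4 * real n + 1) * (cbin n)\<^sup>2 * leg_moment j n)"
    by (simp only: right_diff_distrib sum_subtractf sum_distrib_left mult_ac)
  moreover have "(\<Sum>n\<le>Suc j. (4 * real n + 1) * (cbin n)\<^sup>2 * leg_moment j n) = 2 * cbin j"
    using Suc.IH by (simp add: leg_moment_eq_0)
  ultimately have "(2 * real j + 2) * ((2 * real j + 2) * (\<Sum>n\<le>Suc j. (4 * real n + 1) * (cbin n)\<^sup>2 * leg_moment (Suc j) n))
     = (2 * real j + 2) * ((2 * real j + 1) * (2 * cbin j))"
    by (simp only: power2_eq_square mult.assoc)
  then have "(2 * real j + 2) * (\<Sum>n\<le>Suc j. (4 * real n + 1) * (cbin n)\<^sup>2 * leg_moment (Suc j) n)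
     = (2 * real j + 1) * (2 * cbin j)"
    by (subst (asm) mult_left_cancel) auto
  then show ?case by (simp add: cbin_Suc field_simps del: sum.atMost_Suc)
qed

text \<open>Multiplication by \<open>2n(2n+1)\<close> on the Legendre side is the Legendre differential operator,
  which sends the monomial of exponent \<open>2j\<close> to a combination of exponents \<open>2j\<close> and \<open>2j-2\<close>; this turns
  the previous sum into a recurrence in \<open>j\<close>.\<close>

lemma leg_moment_weighted_sum:
  "(2 * real j + 1) *
     (\<Sum>n=1..j. (4 * real n + 1) / (2 * real n * (2 * real n + 1)) * (cbin n)\<^sup>2 * leg_moment j n)
   = (\<Sum>i=1..j. (cbin i - 1 / (2 * real i + 1)) / real i)"
proof (induction j)
  case (Suc j)
  define w where "w n = (4 * real n + 1) / (2 * real n * (2 * real n + 1)) * (cbin n)\<^sup>2" for n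
  define x where "x = 2 * real j"
  \<comment> \<open>By the recurrence in j, the bracket times x+2 is y(y+1) times the weighted
    moment, with y = 2n. This eigenvalue cancels the denominator of \<open>w n\<close>; at n = 0
    that denominator is 0, hence the restriction.\<close>
  have step: "(x + 2) * ((x + 3) * (w n * leg_moment (Suc j) n) - (x + 1) * (w n * leg_moment j n))
      = (4 * real n + 1) * (cbin n)\<^sup>2 * leg_moment (Suc j) n" if "n \<ge> 1" for n
  proof -
    define y where "y = 2 * real n"
    have r: "leg_moment (Suc j) n * (x + 2 - y) * (x + y + 3) = leg_moment j n * (x + 2) * (x + 1)"
      using leg_moment_Suc_left[of j n] by (simp add: x_def y_def algebra_simps)
    have "w n * (y * (y + 1)) = (4 * real n + 1) * (cbin n)\<^sup>2"
      using that by (simp add: w_def y_def add_eq_0_iff)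
    moreover have "(x + 2) * ((x + 3) * (w n * leg_moment (Suc j) n) - (x + 1) * (w n * leg_moment j n))
       = w n * (y * (y + 1)) * leg_moment (Suc j) n"
      using r by algebra
    ultimately show ?thesis by simp
  qed
  have "(x + 2) * ((x + 3) * (\<Sum>n=1..Suc j. w n * leg_moment (Suc j) n) - (x + 1) * (\<Sum>n=1..Suc j. w n * leg_moment j n))
     = (\<Sum>n=1..Suc j. (x + 2) * ((x + 3) * (w n * leg_moment (Suc j) n) - (x + 1) * (w n * leg_moment j n)))"
    by (simp only: sum_distrib_left right_diff_distrib sum_subtractf)
  also have "\<dots> = (\<Sum>n=1..Suc j. (4 * real n + 1) * (cbin n)\<^sup>2 * leg_moment (Suc j) n)"
    by (intro sum.cong refl step) auto
  \<comment> \<open>The known sum starts at n = 0; removing that term produces the subtracted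
    reciprocal of an odd number in the result.\<close>
  also have "\<dots> = (\<Sum>n\<le>Suc j. (4 * real n + 1) * (cbin n)\<^sup>2 * leg_moment (Suc j) n) - leg_moment (Suc j) 0"
    by (simp add: atMost_atLeast0 sum.atLeast_Suc_atMost[of 0 "Suc j"] del: sum.cl_ivl_Suc)
  also have "\<dots> = 2 * cbin (Suc j) - 2 / (x + 3)"
    unfolding leg_moment_sum leg_moment_0 by (simp add: x_def)
  finally have eq: "(x + 2) * ((x + 3) * (\<Sum>n=1..Suc j. w n * leg_moment (Suc j) n) - (x + 1) * (\<Sum>n=1..Suc j. w n * leg_moment j n))
      = 2 * cbin (Suc j) - 2 / (x + 3)" .
  have "(x + 1) * (\<Sum>n=1..Suc j. w n * leg_moment j n) = (x + 1) * (\<Sum>n=1..j. w n * leg_moment j n)"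
    by (simp add: leg_moment_eq_0)
  also have "\<dots> = (\<Sum>i=1..j. (cbin i - 1 / (2 * real i + 1)) / real i)"
    using Suc.IH by (simp add: x_def w_def)
  finally have IH: "(x + 1) * (\<Sum>n=1..Suc j. w n * leg_moment j n) = \<dots>" .
  have pos: "x + 2 > 0" by (simp add: x_def)
  have "(x + 3) * (\<Sum>n=1..Suc j. w n * leg_moment (Suc j) n) =
      (\<Sum>i=1..j. (cbin i - 1 / (2 * real i + 1)) / real i) + (2 * cbin (Suc j) - 2 / (x + 3)) / (x + 2)"
  proof -
    have "a = b + e / p" if "p * (a - b) = e" "p > 0" for a b e p :: real
      using that by (auto simp: field_simps)
    from this[OF eq pos] show ?thesis unfolding IH .
  qed
  also have "(2 * cbin (Suc j) - 2 / (x + 3)) / (x + 2) = (cbin (Suc j) - 1 / (2 * real (Suc j) + 1)) / real (Suc j)"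
  proof -
    have "x + 2 = 2 * real (Suc j)" "x + 3 = 2 * real (Suc j) + 1" by (simp_all add: x_def)
    moreover have "(2 * a - 2 / y) / (2 * z) = (a - 1 / y) / z" for a y z :: real
    proof -
      have "2 * a - 2 / y = 2 * (a - 1 / y)" by (simp add: algebra_simps)
      moreover have "2 * (a - 1 / y) / (2 * z) = (a - 1 / y) / z"
        by (rule mult_divide_mult_cancel_left) simp
      ultimately show ?thesis by (simp only:)
    qed
    ultimately show ?thesis by (simp only:)
  qed
  finally show ?case
    by (simp add: w_def x_def algebra_simps)
qed simp

text \<open>Formally, both sides are the integral of P_2n(x)/sqrt(1-x^2) over [-1,1]. Telescoping in
  j links n+1 to n; the case n = 0 is the arcsine series at 1, which is assumed here and proved
  below.\<close>

lemma leg_moment_series: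
  assumes "(\<lambda>j. cbin j / (2 * real j + 1)) sums (pi / 2)"
  shows "(\<lambda>j. cbin j * leg_moment j n) sums (pi * (cbin n)\<^sup>2)"
proof (induction n)
  case 0
  from sums_mult[OF assms, of 2] show ?case by (simp add: leg_moment_0 mult_ac)
next
  case (Suc n)
  define y where "y = 2 * real n"
  \<comment> \<open>The certificate in the variable j. It vanishes at j = 0: through the factor 2j-y
    if n = 0, through the moment otherwise.\<close>
  define G where "G j = (2 * y + 3) * (2 * real j - y) * cbin j * leg_moment j n" for j
  have step: "(y + 2)\<^sup>2 * (cbin j * leg_moment j (Suc n)) - (y + 1)\<^sup>2 * (cbin j * leg_moment j n)
      = G j - G (Suc j)" for j
  proof -
    define x where "x = 2 * real j"
    have r: "leg_moment j (Suc n) * (x + y + 3) = leg_moment j n * (x - y)"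
            "leg_moment (Suc j) n * (x + 2 - y) * (x + y + 3) = leg_moment j n * (x + 2) * (x + 1)"
      using leg_moment_Suc_right[of j n] leg_moment_Suc_left[of j n]
      by (simp_all add: x_def y_def algebra_simps)
    have b: "cbin (Suc j) * (x + 2) = cbin j * (x + 1)"
      by (simp add: cbin_Suc x_def add_eq_0_iff)
    have pos: "x + y + 3 > 0" by (simp add: x_def y_def)
    have G': "G (Suc j) = (2 * y + 3) * (x + 2 - y) * cbin (Suc j) * leg_moment (Suc j) n"
      by (simp add: G_def x_def algebra_simps)
    have "G (Suc j) * (x + y + 3) = (2 * y + 3) * cbin (Suc j) * (leg_moment (Suc j) n * (x + 2 - y) * (x + y + 3))"
      unfolding G' by algebra
    also have "\<dots> = (2 * y + 3) * (cbin (Suc j) * (x + 2)) * leg_moment j n * (x + 1)"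
      unfolding r(2) by algebra
    finally have G: "G (Suc j) * (x + y + 3) = (2 * y + 3) * cbin j * (x + 1)\<^sup>2 * leg_moment j n"
      unfolding b by algebra
    have G0: "G j = (2 * y + 3) * (x - y) * cbin j * leg_moment j n"
      by (simp add: G_def x_def)
    have "((y + 2)\<^sup>2 * (cbin j * leg_moment j (Suc n)) - (y + 1)\<^sup>2 * (cbin j * leg_moment j n)) * (x + y + 3)
       = (y + 2)\<^sup>2 * cbin j * (leg_moment j (Suc n) * (x + y + 3)) - (y + 1)\<^sup>2 * (cbin j * leg_moment j n) * (x + y + 3)"
      by algebra
    also have "\<dots> = G j * (x + y + 3) - G (Suc j) * (x + y + 3)"
      unfolding r(1) G unfolding G0 by algebra
    also have "\<dots> = (G j - G (Suc j)) * (x + y + 3)"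
      by algebra
    finally show ?thesis using pos by simp
  qed
  have "G \<longlonglongrightarrow> 0"
  proof (rule Lim_null_comparison)
    show "(\<lambda>j. 2 * (2 * y + 3) * cbin j) \<longlonglongrightarrow> 0"
      using tendsto_mult_left[OF cbin_tendsto_0, of "2 * (2 * y + 3)"] by simp
    \<comment> \<open>From j = n on, the factor 2j-y is nonnegative, and its product with the moment
      is at most 2; the decay is that of \<open>cbin j\<close>.\<close>
    have "norm (G j) \<le> 2 * (2 * y + 3) * cbin j" if "j \<ge> n" for j
    proof -
      have y0: "y \<ge> 0" by (simp add: y_def)
      have "(2 * real j - y) * leg_moment j n \<le> (2 * real j + 1) * leg_moment j n"
        using y0 by (intro mult_right_mono leg_moment_nonneg) auto
      also have "\<dots> \<le> 2" using leg_moment_le[of j n] by (simp add: mult.commute)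
      finally have "(2 * y + 3) * cbin j * ((2 * real j - y) * leg_moment j n) \<le> (2 * y + 3) * cbin j * 2"
        using y0 cbin_pos[of j] by (intro mult_left_mono) auto
      moreover have "G j \<ge> 0"
        unfolding G_def using that y0 cbin_pos[of j] leg_moment_nonneg[of j n] by (simp add: y_def)
      ultimately show ?thesis by (simp add: G_def mult_ac)
    qed
    then show "\<forall>\<^sub>F j in sequentially. norm (G j) \<le> 2 * (2 * y + 3) * cbin j"
      using eventually_sequentially by blast
  qed
  from telescope_sums'[OF this] have "(\<lambda>j. G j - G (Suc j)) sums G 0" by simp
  moreover have "G 0 = 0"
    by (cases "n = 0") (simp_all add: G_def y_def leg_moment_eq_0)
  ultimately have "(\<lambda>j. (y + 2)\<^sup>2 * (cbin j * leg_moment j (Suc n)) - (y + 1)\<^sup>2 * (cbin j * leg_moment j n)) sums 0"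
    by (simp add: step)
  from sums_add[OF this sums_mult[OF Suc.IH, of "(y + 1)\<^sup>2"]]
  have "(\<lambda>j. (y + 2)\<^sup>2 * (cbin j * leg_moment j (Suc n))) sums ((y + 1)\<^sup>2 * (pi * (cbin n)\<^sup>2))"
    by simp
  from sums_mult[OF this, of "1 / (y + 2)\<^sup>2"]
  have "(\<lambda>j. cbin j * leg_moment j (Suc n)) sums (1 / (y + 2)\<^sup>2 * ((y + 1)\<^sup>2 * (pi * (cbin n)\<^sup>2)))"
    by (simp add: y_def add_eq_0_iff)
  then show ?case
    by (simp add: cbin_Suc y_def power_divide power_mult_distrib mult_ac)
qed

section \<open>Exchange of summations\<close>

text \<open>Tonelli's theorem in two inequalities. Finitely many rows are dominated by the column
  sums, and by triangularity the first J columns lie within the first J rows. Summability of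
  \<open>r\<close> is part of the conclusion.\<close>

lemma sums_triangular_swap:
  fixes f :: "nat \<Rightarrow> nat \<Rightarrow> real"
  assumes nonneg: "\<And>n j. f n j \<ge> 0"
    and triangular: "\<And>n j. j < n \<Longrightarrow> f n j = 0"
    and rows: "\<And>n. f n sums r n"
    and cols: "(\<lambda>j. \<Sum>n\<le>j. f n j) sums s"
  shows "r sums s"
proof -
  have r0: "r n \<ge> 0" for n
    using rows[of n] nonneg sums_le[OF _ sums_zero] by metis
  have upper: "(\<Sum>n<N. r n) \<le> s" for N
  proof (rule sums_le[OF _ sums_sum[OF rows] cols])
    fix j
    have "(\<Sum>n<N. f n j) \<le> (\<Sum>n\<in>{..<N} \<union> {..j}. f n j)"
      by (intro sum_mono2) (auto simp: nonneg)
    also have "\<dots> = (\<Sum>n\<le>j. f n j)"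
      by (intro sum.mono_neutral_right) (auto simp: triangular)
    finally show "(\<Sum>n<N. f n j) \<le> (\<Sum>n\<le>j. f n j)" .
  qed
  have "summable r"
    using upper r0 by (intro summableI_nonneg_bounded)
  then have "suminf r \<le> s"
    using upper by (intro suminf_le_const)
  moreover have "s \<le> suminf r"
  proof (rule LIMSEQ_le_const2)
    show "(\<lambda>J. \<Sum>j<J. \<Sum>n\<le>j. f n j) \<longlonglongrightarrow> s" using cols by (simp add: sums_def)
    have "(\<Sum>j<J. \<Sum>n\<le>j. f n j) \<le> suminf r" for J
    proof -
      have "(\<Sum>j<J. \<Sum>n\<le>j. f n j) = (\<Sum>j<J. \<Sum>n<J. f n j)"
        by (intro sum.cong refl sum.mono_neutral_left) (auto simp: triangular)
      also have "\<dots> = (\<Sum>n<J. \<Sum>j<J. f n j)"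
        by (rule sum.swap)
      also have "\<dots> \<le> (\<Sum>n<J. r n)"
        using rows nonneg by (intro sum_mono) (metis sums_unique sum_le_suminf sums_summable finite_lessThan)
      also have "\<dots> \<le> suminf r"
        using \<open>summable r\<close> r0 by (intro sum_le_suminf) auto
      finally show ?thesis .
    qed
    then show "\<exists>N. \<forall>J\<ge>N. (\<Sum>j<J. \<Sum>n\<le>j. f n j) \<le> suminf r" by blast
  qed
  ultimately show ?thesis
    using \<open>summable r\<close> by (simp add: sums_iff)
qed

section \<open>The series as an integral\<close>

lemma gbinomial_minus_half: "((- 1 / 2 :: real) gchoose n) = (- 1) ^ n * cbin n"
proof (induction n)
  case (Suc n)
  have "((- 1 / 2 :: real) gchoose Suc n) = ((- 1 / 2) gchoose n) * (- 1 / 2 - real n) / (real n + 1)"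
    by (simp add: gbinomial_prod_rev)
  also have "\<dots> = (- 1) ^ n * cbin n * (- 1 / 2 - real n) / (real n + 1)"
    by (simp only: Suc.IH)
  also have "\<dots> = (- 1) ^ Suc n * cbin (Suc n)"
    by (simp add: cbin_Suc divide_simps) (simp add: algebra_simps)
  finally show ?case .
qed simp

lemma inverse_sqrt_series:
  fixes x :: real
  assumes "\<bar>x\<bar> < 1"
  shows "(\<lambda>j. cbin j * x ^ (2 * j)) sums (1 / sqrt (1 - x\<^sup>2))"
proof -
  have x: "\<bar>- x\<^sup>2\<bar> < 1" using assms by (simp add: abs_square_less_1)
  have "((- 1) ^ j * cbin j) * (- x\<^sup>2) ^ j = cbin j * x ^ (2 * j)" for j
  proof -
    have "((- 1) ^ j * cbin j) * (- x\<^sup>2) ^ j = ((- 1) ^ j * (- 1) ^ j) * cbin j * (x\<^sup>2) ^ j"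
      by (subst power_minus) (simp only: mult_ac)
    then show ?thesis by (simp add: power_mult)
  qed
  with gen_binomial_real[OF x, of "- 1 / 2"]
  have "(\<lambda>j. cbin j * x ^ (2 * j)) sums (1 - x\<^sup>2) powr (- 1 / 2)"
    by (simp only: gbinomial_minus_half) simp
  also have "(1 - x\<^sup>2) powr (- 1 / 2) = 1 / sqrt (1 - x\<^sup>2)"
    using x by (simp add: powr_minus_divide powr_half_sqrt)
  finally show ?thesis .
qed

text \<open>Termwise differentiation gives the series of 1/sqrt(1-x^2), uniformly convergent on
  \<open>{-r..r}\<close> for r < 1. The difference from \<open>arcsin\<close> thus has derivative 0
  on the open interval, and it vanishes at 0.\<close>

lemma arcsin_series_interior:
  fixes y :: real
  assumes "\<bar>y\<bar> < 1"
  shows "(\<lambda>j. cbin j / (2 * real j + 1) * y ^ (2 * j + 1)) sums arcsin y"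
proof -
  define f where "f j x = cbin j / (2 * real j + 1) * x ^ (2 * j + 1)" for j and x :: real
  have der: "((\<lambda>x. \<Sum>j. f j x) has_field_derivative 1 / sqrt (1 - x\<^sup>2)) (at x)"
    and summ: "summable (\<lambda>j. f j x)" if "\<bar>x\<bar> < 1" for x
  proof -
    obtain r where r: "\<bar>x\<bar> < r" "r < 1" using dense[of "\<bar>x\<bar>" 1] \<open>\<bar>x\<bar> < 1\<close> by blast
    have r': "\<bar>r\<bar> < 1" using r by auto
    have d: "(f j has_field_derivative cbin j * t ^ (2 * j)) (at t within {-r..r})" for j t
      using DERIV_cmult[OF DERIV_power_Suc[OF DERIV_ident], of "cbin j / (2 * real j + 1)" "2 * j" t "{-r..r}"]
      by (simp add: f_def[abs_def] add_eq_0_iff add.commute divide_simps)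
    have u: "uniformly_convergent_on {-r..r} (\<lambda>n t. \<Sum>j<n. cbin j * t ^ (2 * j))"
    proof (rule Weierstrass_m_test')
      show "summable (\<lambda>j. cbin j * r ^ (2 * j))"
        using inverse_sqrt_series[OF r'] by (rule sums_summable)
      fix j t assume "t \<in> {-r..r}"
      then have "\<bar>t\<bar> ^ (2 * j) \<le> r ^ (2 * j)" by (intro power_mono) auto
      then show "norm (cbin j * t ^ (2 * j)) \<le> cbin j * r ^ (2 * j)"
        using cbin_pos[of j] by (simp add: abs_mult power_abs)
    qed
    have x: "x \<in> interior {-r..r}" using r by auto
    have s0: "summable (\<lambda>j. f j 0)" by (simp add: f_def)
    have 0: "0 \<in> {-r..r}" using r by auto
    have conv: "convex {-r..r}" by simp
    note * = has_field_derivative_series'[OF conv d u 0 s0 x]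
    show "summable (\<lambda>j. f j x)" by (fact *(1))
    show "((\<lambda>x. \<Sum>j. f j x) has_field_derivative 1 / sqrt (1 - x\<^sup>2)) (at x)"
      using *(2) sums_unique[OF inverse_sqrt_series[OF that]] by simp
  qed
  have "(\<Sum>j. f j y) - arcsin y = (\<Sum>j. f j 0) - arcsin 0"
  proof (rule exE[OF has_field_derivative_zero_constant[of "{-1<..<1}" "\<lambda>x. (\<Sum>j. f j x) - arcsin x"]])
    fix x :: real assume "x \<in> {-1<..<1}"
    then have "((\<lambda>x. (\<Sum>j. f j x) - arcsin x) has_field_derivative 1 / sqrt (1 - x\<^sup>2) - inverse (sqrt (1 - x\<^sup>2))) (at x)"
      by (intro DERIV_diff der DERIV_arcsin) auto
    then show "((\<lambda>x. (\<Sum>j. f j x) - arcsin x) has_field_derivative 0) (at x within {-1<..<1})"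
      by (simp add: divide_inverse has_field_derivative_at_within)
  next
    fix c assume c: "\<forall>x\<in>{-1<..<1}. (\<Sum>j. f j x) - arcsin x = c"
    have "y \<in> {-1<..<1}" "0 \<in> {-1<..<1::real}" using assms by auto
    with c show ?thesis by metis
  qed auto
  then have "(\<Sum>j. f j y) = arcsin y" by (simp add: f_def)
  with summ[OF assms] have "(\<lambda>j. f j y) sums arcsin y" by (simp add: sums_iff)
  then show ?thesis unfolding f_def .
qed

text \<open>For 0 < y < 1 the partial sums of the nonnegative terms are at most
  \<open>arcsin y\<close>, hence at most pi/2; letting y tend to 1 bounds the partial sums of the
  coefficients.\<close>

lemma arcsin_coeffs_summable: "summable (\<lambda>j. cbin j / (2 * real j + 1))"
proof (rule summableI_nonneg_bounded)
  fix n
  show "cbin n / (2 * real n + 1) \<ge> 0" using cbin_pos[of n] by simp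
  have lim: "((\<lambda>y. \<Sum>j<n. cbin j / (2 * real j + 1) * y ^ (2 * j + 1)) \<longlongrightarrow>
      (\<Sum>j<n. cbin j / (2 * real j + 1) * 1 ^ (2 * j + 1))) (at_left 1)"
    by (intro tendsto_intros)
  have "(\<Sum>j<n. cbin j / (2 * real j + 1) * 1 ^ (2 * j + 1)) \<le> pi / 2"
  proof (rule tendsto_upperbound[OF lim])
    have "(\<Sum>j<n. cbin j / (2 * real j + 1) * y ^ (2 * j + 1)) \<le> pi / 2" if "y \<in> {0<..<1}" for y
    proof -
      have "(\<Sum>j<n. cbin j / (2 * real j + 1) * y ^ (2 * j + 1)) \<le> arcsin y"
      proof -
        have "(\<lambda>j. cbin j / (2 * real j + 1) * y ^ (2 * j + 1)) sums arcsin y"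
          using that by (intro arcsin_series_interior) auto
        moreover have "cbin j / (2 * real j + 1) * y ^ (2 * j + 1) \<ge> 0" for j
          using that cbin_pos[of j] by simp
        ultimately show ?thesis
          using sum_le_suminf[of "\<lambda>j. cbin j / (2 * real j + 1) * y ^ (2 * j + 1)" "{..<n}"]
          by (simp add: sums_iff)
      qed
      also have "\<dots> \<le> pi / 2" using that by (intro arcsin_ubound) auto
      finally show ?thesis .
    qed
    then show "\<forall>\<^sub>F y in at_left 1. (\<Sum>j<n. cbin j / (2 * real j + 1) * y ^ (2 * j + 1)) \<le> pi / 2"
      using eventually_at_left_real[of 0 1] by (simp add: eventually_mono)
  qed simp
  then show "(\<Sum>j<n. cbin j / (2 * real j + 1)) \<le> pi / 2" by simp
qed

text \<open>The endpoint y = 1 is an Abel limit: the coefficients are a summable majorant on [0,1],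
  so the sum is continuous there and the interior identity passes to the left limit.\<close>

lemma arcsin_series:
  fixes y :: real
  assumes "0 \<le> y" "y \<le> 1"
  shows "(\<lambda>j. cbin j / (2 * real j + 1) * y ^ (2 * j + 1)) sums arcsin y"
proof (cases "y = 1")
  case False
  with assms show ?thesis by (intro arcsin_series_interior) auto
next
  case True
  define f where "f j x = cbin j / (2 * real j + 1) * x ^ (2 * j + 1)" for j and x :: real
  have "uniform_limit {0..1} (\<lambda>n x. \<Sum>j<n. f j x) (\<lambda>x. \<Sum>j. f j x) sequentially"
  proof (rule Weierstrass_m_test[OF _ arcsin_coeffs_summable])
    fix j and x :: real assume "x \<in> {0..1}"
    then have "\<bar>x\<bar> ^ (2 * j + 1) \<le> 1" by (intro power_le_one) auto
    then have "cbin j / (2 * real j + 1) * \<bar>x\<bar> ^ (2 * j + 1) \<le> cbin j / (2 * real j + 1) * 1"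
      using cbin_pos[of j] by (intro mult_left_mono) auto
    then show "norm (f j x) \<le> cbin j / (2 * real j + 1)"
      using cbin_pos[of j] by (simp add: f_def abs_mult power_abs)
  qed
  then have "continuous_on {0..1} (\<lambda>x. \<Sum>j. f j x)"
    by (rule uniform_limit_theorem[rotated]) (auto simp: f_def intro!: always_eventually continuous_intros)
  then have lim: "((\<lambda>x. \<Sum>j. f j x) \<longlongrightarrow> (\<Sum>j. f j 1)) (at_left 1)"
    by (rule continuous_on_Icc_at_leftD) simp
  have ev: "\<forall>\<^sub>F x in at_left 1. arcsin x = (\<Sum>j. f j x)"
  proof (rule eventually_mono[OF eventually_at_left_real[of 0 1]])
    fix x :: real assume "x \<in> {0<..<1}"
    then have "(\<lambda>j. f j x) sums arcsin x"
      unfolding f_def by (intro arcsin_series_interior) auto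
    then show "arcsin x = (\<Sum>j. f j x)" by (rule sums_unique)
  qed simp
  have "(arcsin \<longlongrightarrow> arcsin 1) (at_left 1)"
    by (rule continuous_on_Icc_at_leftD[of "-1"]) (auto intro: continuous_on_arcsin')
  then have "((\<lambda>x. \<Sum>j. f j x) \<longlongrightarrow> arcsin 1) (at_left 1)"
    unfolding tendsto_cong[OF ev] .
  with lim have "(\<Sum>j. f j 1) = arcsin 1"
    by (rule tendsto_unique[OF trivial_limit_at_left_real])
  moreover have "summable (\<lambda>j. f j 1)" using arcsin_coeffs_summable by (simp add: f_def)
  ultimately have "(\<lambda>j. f j 1) sums arcsin 1" by (simp add: sums_iff)
  with True show ?thesis by (simp add: f_def)
qed

section \<open>Integrals of powers of cosine, and termwise integration\<close>

lemma DERIV_cos_power_Suc: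
  "((\<lambda>s. cos s ^ Suc m) has_field_derivative - ((real m + 1) * cos s ^ m * sin s)) (at s within S)"
  for s :: real
  by (rule derivative_eq_intros refl | simp)+

text \<open>Wallis' integral: \<open>sin s * cos s ^ (2 * i + 1)\<close> vanishes at both ends, and
  integrating its derivative gives the recurrence of \<open>cbin\<close>.\<close>

lemma has_integral_cos_even_power:
  "((\<lambda>s. cos s ^ (2 * i)) has_integral (pi / 2 * cbin i)) {0..pi / 2}"
proof (induction i)
  case 0
  then show ?case using has_integral_const_real[of "1::real" 0 "pi / 2"] by simp
next
  case (Suc i)
  have "((\<lambda>s. (2 * real i + 2) * cos s ^ (2 * Suc i) - (2 * real i + 1) * cos s ^ (2 * i))
     has_integral (sin (pi / 2) * cos (pi / 2) ^ (2 * i + 1) - sin 0 * cos 0 ^ (2 * i + 1))) {0..pi / 2}"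
  proof (rule fundamental_theorem_of_calculus)
    fix s :: real
    have "((\<lambda>s. sin s * cos s ^ (2 * i + 1)) has_field_derivative
        (cos s * cos s ^ (2 * i + 1) - (2 * real i + 1) * (sin s)\<^sup>2 * cos s ^ (2 * i))) (at s within {0..pi / 2})"
      using DERIV_mult[OF has_field_derivative_at_within[OF DERIV_sin] DERIV_cos_power_Suc[of "2 * i" s "{0..pi / 2}"]]
      by (simp add: power2_eq_square algebra_simps)
    also have "cos s * cos s ^ (2 * i + 1) - (2 * real i + 1) * (sin s)\<^sup>2 * cos s ^ (2 * i)
       = (2 * real i + 2) * cos s ^ (2 * Suc i) - (2 * real i + 1) * cos s ^ (2 * i)"
      unfolding sin_squared_eq by (simp add: power2_eq_square algebra_simps)
    finally show "((\<lambda>s. sin s * cos s ^ (2 * i + 1)) has_vector_derivative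
        (2 * real i + 2) * cos s ^ (2 * Suc i) - (2 * real i + 1) * cos s ^ (2 * i)) (at s within {0..pi / 2})"
      by (simp add: has_real_derivative_iff_has_vector_derivative)
  qed simp
  from has_integral_mult_right[OF has_integral_add[OF this has_integral_mult_right[OF Suc.IH, of "2 * real i + 1"]], of "1 / (2 * real i + 2)"]
  show ?case by (simp add: cbin_Suc add_eq_0_iff mult_ac)
qed

text \<open>The derivative \<open>2/\<pi> - sin\<close> of \<open>leg_phi\<close> pairs with the even powers of \<open>cos\<close> to give the
  summands in the weighted Legendre moment sums, and \<open>leg_phi\<close> vanishes at both ends of \<open>[0, \<pi>/2]\<close>.\<close>

definition leg_phi :: "real \<Rightarrow> real" where
  "leg_phi s = cos s - 1 + 2 * s / pi"

text \<open>Integration by parts with no boundary contribution. In the derivative of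
  \<open>leg_phi\<close>, the constant 2/pi produces the Wallis integral and the sine produces
  1/(2i+3).\<close>

lemma has_integral_leg_phi_cos_power:
  "((\<lambda>s. 2 * leg_phi s * (cos s ^ (2 * i + 1) * sin s)) has_integral
     ((cbin (Suc i) - 1 / (2 * real (Suc i) + 1)) / real (Suc i))) {0..pi / 2}"
proof -
  have 1: "((\<lambda>s. 2 * leg_phi s * (cos s ^ (2 * i + 1) * sin s)
       - 1 / (real i + 1) * (2 / pi * cos s ^ (2 * Suc i) - cos s ^ (2 * i + 2) * sin s))
      has_integral (- leg_phi (pi / 2) * cos (pi / 2) ^ (2 * i + 2) / (real i + 1)
         - (- leg_phi 0 * cos 0 ^ (2 * i + 2) / (real i + 1)))) {0..pi / 2}"
  proof (rule fundamental_theorem_of_calculus)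
    fix s :: real
    have "((\<lambda>s. - leg_phi s * cos s ^ (2 * i + 2) / (real i + 1)) has_field_derivative
       ((sin s - 2 / pi) * cos s ^ (2 * i + 2) + leg_phi s * ((2 * real i + 2) * cos s ^ (2 * i + 1) * sin s)) / (real i + 1))
       (at s within {0..pi / 2})"
    proof -
      have "(leg_phi has_field_derivative 2 / pi - sin s) (at s within {0..pi / 2})"
        unfolding leg_phi_def by (auto intro!: derivative_eq_intros)
      from DERIV_cdivide[OF DERIV_minus[OF DERIV_mult[OF this DERIV_cos_power_Suc[of "2 * i + 1" s "{0..pi / 2}"]]], of "real i + 1"]
      show ?thesis by (simp add: algebra_simps)
    qed
    also have "((sin s - 2 / pi) * cos s ^ (2 * i + 2) + leg_phi s * ((2 * real i + 2) * cos s ^ (2 * i + 1) * sin s)) / (real i + 1)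
       = 2 * leg_phi s * (cos s ^ (2 * i + 1) * sin s)
         - 1 / (real i + 1) * (2 / pi * cos s ^ (2 * Suc i) - cos s ^ (2 * i + 2) * sin s)"
      by (simp add: divide_simps add_eq_0_iff) (simp add: algebra_simps)
    finally show "((\<lambda>s. - leg_phi s * cos s ^ (2 * i + 2) / (real i + 1)) has_vector_derivative
       2 * leg_phi s * (cos s ^ (2 * i + 1) * sin s)
         - 1 / (real i + 1) * (2 / pi * cos s ^ (2 * Suc i) - cos s ^ (2 * i + 2) * sin s)) (at s within {0..pi / 2})"
      by (simp add: has_real_derivative_iff_has_vector_derivative)
  qed simp
  have 2: "((\<lambda>s. cos s ^ (2 * i + 2) * sin s) has_integral
      (- (cos (pi / 2) ^ (2 * i + 3)) / (2 * real i + 3) - (- (cos 0 ^ (2 * i + 3)) / (2 * real i + 3)))) {0..pi / 2}"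
  proof (rule fundamental_theorem_of_calculus)
    fix s :: real
    have "((\<lambda>s. - (cos s ^ (2 * i + 3)) / (2 * real i + 3)) has_field_derivative
       cos s ^ (2 * i + 2) * sin s) (at s within {0..pi / 2})"
    proof -
      have "((\<lambda>s. - (cos s ^ Suc (2 * i + 2)) / (2 * real i + 3)) has_field_derivative
          - (- ((real (2 * i + 2) + 1) * cos s ^ (2 * i + 2) * sin s)) / (2 * real i + 3)) (at s within {0..pi / 2})"
        by (intro DERIV_cdivide DERIV_minus DERIV_cos_power_Suc)
      moreover have "- (- ((real (2 * i + 2) + 1) * cos s ^ (2 * i + 2) * sin s)) / (2 * real i + 3)
          = cos s ^ (2 * i + 2) * sin s"
        by (simp add: add_eq_0_iff divide_eq_eq)
      ultimately show ?thesis by (simp add: numeral_3_eq_3)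
    qed
    then show "((\<lambda>s. - (cos s ^ (2 * i + 3)) / (2 * real i + 3)) has_vector_derivative
       cos s ^ (2 * i + 2) * sin s) (at s within {0..pi / 2})"
      by (simp add: has_real_derivative_iff_has_vector_derivative)
  qed simp
  have 3: "((\<lambda>s. 1 / (real i + 1) * (2 / pi * cos s ^ (2 * Suc i) - cos s ^ (2 * i + 2) * sin s)) has_integral
      1 / (real i + 1) * (2 / pi * (pi / 2 * cbin (Suc i)) - 1 / (2 * real i + 3))) {0..pi / 2}"
    using 2 by (intro has_integral_mult_right has_integral_diff has_integral_cos_even_power) (simp add: power_0_left)
  from has_integral_add[OF 1 3] show ?thesis
    by (simp add: leg_phi_def add_ac)
qed

lemma cos_power_sum:
  "sin s * (\<Sum>i<j. cos s ^ (2 * i + 1) * sin s) = cos s - cos s ^ (2 * j + 1)" for s :: real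
proof (induction j)
  case (Suc j)
  have "sin s * (\<Sum>i<Suc j. cos s ^ (2 * i + 1) * sin s)
     = sin s * (\<Sum>i<j. cos s ^ (2 * i + 1) * sin s) + cos s ^ (2 * j + 1) * (sin s)\<^sup>2"
    by (simp add: distrib_left power2_eq_square mult_ac)
  also have "\<dots> = cos s - cos s ^ (2 * j + 1) + cos s ^ (2 * j + 1) * (1 - (cos s)\<^sup>2)"
    unfolding Suc.IH sin_squared_eq ..
  also have "\<dots> = cos s - cos s ^ (2 * Suc j + 1)"
    by (simp add: power2_eq_square algebra_simps)
  finally show ?case .
qed simp

section \<open>Estimates near 0\<close>

text \<open>By concavity sine lies above its chord 2s/pi on this interval; pi < 4 then gives a
  constant free of pi.\<close>

lemma le_two_sin:
  assumes "0 \<le> s" "s \<le> pi / 2"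
  shows "s \<le> 2 * sin s"
proof -
  have "concave_on {0..pi / 2} sin"
    by (rule f''_le0_imp_concave[where f' = cos and f'' = "\<lambda>x. - sin x"])
       (auto intro!: derivative_eq_intros sin_ge_zero)
  from concave_onD_Icc[OF this, of "2 * s / pi"] assms
  have "2 * s / pi \<le> sin s" by (simp add: field_simps)
  moreover have "s / 2 \<le> 2 * s / pi"
    using assms pi_less_4 mult_left_mono[of pi 4 s] by (simp add: field_simps)
  ultimately show ?thesis by simp
qed

text \<open>Sine and cosine lie in [0,1], so 1 = sin^2 + cos^2 <= sin + cos.\<close>

lemma one_minus_cos_le_sin:
  assumes "0 \<le> s" "s \<le> pi / 2"
  shows "1 - cos s \<le> sin s"
proof -
  have "0 \<le> sin s" "0 \<le> cos s"
    using assms by (auto intro!: sin_ge_zero cos_ge_zero)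
  then have "(sin s)\<^sup>2 \<le> sin s" "(cos s)\<^sup>2 \<le> cos s"
    by (auto simp: power2_eq_square intro!: mult_left_le)
  then show ?thesis
    using sin_cos_squared_add[of s] by linarith
qed

lemma abs_leg_phi_le:
  assumes "0 \<le> s" "s \<le> pi / 2"
  shows "\<bar>leg_phi s\<bar> \<le> 3 * sin s"
proof -
  have s0: "0 \<le> sin s" "0 \<le> cos s"
    using assms by (auto intro!: sin_ge_zero cos_ge_zero)
  have 1: "1 - cos s \<le> sin s" by (rule one_minus_cos_le_sin[OF assms])
  have "2 * s / pi \<le> s"
    using assms pi_gt3 mult_left_mono[of 2 pi s] by (simp add: field_simps)
  then have "2 * s / pi \<le> 2 * sin s" "0 \<le> 2 * s / pi"
    using le_two_sin[OF assms] assms by auto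
  then show ?thesis
    unfolding leg_phi_def using cos_le_one[of s] 1 s0 by linarith
qed

text \<open>Since \<open>arcsin (cos s) = \<pi>/2 - s\<close>, summing the arcsine series reproduces a second factor \<open>leg_phi\<close>.\<close>

lemma leg_phi_series:
  assumes "0 \<le> s" "s \<le> pi / 2"
  shows "(\<lambda>j. cbin j / (2 * real j + 1) * (2 * leg_phi s * (\<Sum>i<j. cos s ^ (2 * i + 1) * sin s)))
           sums (pi * ((leg_phi s)\<^sup>2 / sin s))"
\<comment> \<open>If sin s = 0, every term contains a factor 0 and the claimed sum is 0 as a
  division by zero.\<close>
proof (cases "sin s = 0")
  case False
  have c: "0 \<le> cos s" using assms by (intro cos_ge_zero) auto
  have "(\<lambda>j. cbin j / (2 * real j + 1) * cos s ^ (2 * j + 1)) sums arcsin (cos s)"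
    using c by (intro arcsin_series) auto
  moreover have "arcsin (cos s) = pi / 2 - s"
    using assms by (subst cos_sin_eq) (simp add: arcsin_sin)
  moreover have "(\<lambda>j. cbin j / (2 * real j + 1)) sums (pi / 2)"
    using arcsin_series[of 1] by simp
  ultimately have "(\<lambda>j. 2 * leg_phi s / sin s *
        (cbin j / (2 * real j + 1) * cos s - cbin j / (2 * real j + 1) * cos s ^ (2 * j + 1)))
      sums (2 * leg_phi s / sin s * (pi / 2 * cos s - (pi / 2 - s)))"
    by (intro sums_mult sums_diff sums_mult2) simp_all
  moreover have "2 * leg_phi s / sin s * (pi / 2 * cos s - (pi / 2 - s)) = pi * ((leg_phi s)\<^sup>2 / sin s)"
  proof -
    have "pi / 2 * cos s - (pi / 2 - s) = pi / 2 * leg_phi s"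
      by (simp add: leg_phi_def field_simps)
    then show ?thesis by (simp add: power2_eq_square)
  qed
  moreover have "2 * leg_phi s / sin s *
        (cbin j / (2 * real j + 1) * cos s - cbin j / (2 * real j + 1) * cos s ^ (2 * j + 1))
      = cbin j / (2 * real j + 1) * (2 * leg_phi s * (\<Sum>i<j. cos s ^ (2 * i + 1) * sin s))" for j
  proof -
    have "2 * leg_phi s / sin s * (v * cos s - v * cos s ^ (2 * j + 1))
       = v * (2 * leg_phi s * ((cos s - cos s ^ (2 * j + 1)) / sin s))" for v
      by (simp add: algebra_simps diff_divide_distrib)
    moreover have "(cos s - cos s ^ (2 * j + 1)) / sin s = (\<Sum>i<j. cos s ^ (2 * i + 1) * sin s)"
      unfolding cos_power_sum[symmetric] using False by simp
    ultimately show ?thesis by (simp only:)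
  qed
  ultimately show ?thesis by (simp only:)
qed simp

text \<open>Termwise integration of the preceding series. The bound \<open>3 * sin s\<close> on
  \<open>leg_phi\<close> and the geometric sum give the majorant 6 times the summable arcsine
  coefficients, so convergence is uniform and the limit is integrable.\<close>

lemma leg_phi_square_integral:
  obtains I where "((\<lambda>s. (leg_phi s)\<^sup>2 / sin s) has_integral I) {0..pi / 2}"
    and "(\<lambda>j. cbin j / (2 * real j + 1) * (\<Sum>i=1..j. (cbin i - 1 / (2 * real i + 1)) / real i)) sums (pi * I)"
proof -
  define f where "f j s = cbin j / (2 * real j + 1) * (2 * leg_phi s * (\<Sum>i<j. cos s ^ (2 * i + 1) * sin s))"
    for j and s :: real
  define U where "U j = cbin j / (2 * real j + 1) * (\<Sum>i=1..j. (cbin i - 1 / (2 * real i + 1)) / real i)" for j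
  have int: "(f j has_integral U j) {0..pi / 2}" for j
  proof -
    have "(\<Sum>i=1..j. (cbin i - 1 / (2 * real i + 1)) / real i) =
        (\<Sum>i<j. (cbin (Suc i) - 1 / (2 * real (Suc i) + 1)) / real (Suc i))"
      by (rule sum.reindex_bij_witness[of _ Suc "\<lambda>i. i - 1"]) auto
    moreover have "((\<lambda>s. \<Sum>i<j. 2 * leg_phi s * (cos s ^ (2 * i + 1) * sin s)) has_integral
        (\<Sum>i<j. (cbin (Suc i) - 1 / (2 * real (Suc i) + 1)) / real (Suc i))) {0..pi / 2}"
      by (intro has_integral_sum has_integral_leg_phi_cos_power) simp
    ultimately show ?thesis
      unfolding f_def U_def by (intro has_integral_mult_right) (simp only: sum_distrib_left)
  qed
  have "uniform_limit {0..pi / 2} (\<lambda>n s. \<Sum>j<n. f j s) (\<lambda>s. \<Sum>j. f j s) sequentially"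
  proof (rule Weierstrass_m_test)
    show "summable (\<lambda>j. 6 * (cbin j / (2 * real j + 1)))"
      by (intro summable_mult arcsin_coeffs_summable)
    fix j s assume s: "s \<in> {0..pi / 2}"
    have c: "0 \<le> cos s" "cos s \<le> 1" using s by (auto intro!: cos_ge_zero)
    have s0: "0 \<le> sin s" using s by (intro sin_ge_zero) auto
    have "\<bar>leg_phi s * (\<Sum>i<j. cos s ^ (2 * i + 1) * sin s)\<bar>
        \<le> 3 * sin s * (\<Sum>i<j. cos s ^ (2 * i + 1) * sin s)"
      unfolding abs_mult using abs_leg_phi_le[of s] s s0 c
      by (intro mult_mono) (auto intro!: sum_nonneg simp: abs_of_nonneg)
    also have "\<dots> = 3 * (cos s - cos s ^ (2 * j + 1))"
      using cos_power_sum[of s j] by (simp add: mult.assoc)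
    also have "\<dots> \<le> 3"
      using c by (simp add: add_increasing2 algebra_simps)
    finally have "cbin j / (2 * real j + 1) * (2 * \<bar>leg_phi s * (\<Sum>i<j. cos s ^ (2 * i + 1) * sin s)\<bar>)
        \<le> cbin j / (2 * real j + 1) * 6"
      using cbin_pos[of j] by (intro mult_left_mono) auto
    then show "norm (f j s) \<le> 6 * (cbin j / (2 * real j + 1))"
      using cbin_pos[of j] by (simp add: f_def abs_mult mult_ac)
  qed
  then obtain A I where A: "\<And>n. ((\<lambda>s. \<Sum>j<n. f j s) has_integral A n) {0..pi / 2}"
    and I: "((\<lambda>s. \<Sum>j. f j s) has_integral I) {0..pi / 2}" and lim: "A \<longlonglongrightarrow> I"
    by (rule uniform_limit_integral) (auto simp: f_def leg_phi_def intro!: continuous_intros)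
  have "A n = (\<Sum>j<n. U j)" for n
    using has_integral_unique[OF A has_integral_sum[OF _ int]] by simp
  then have "A = (\<lambda>n. \<Sum>j<n. U j)" by (rule ext)
  with lim have sums: "U sums I" by (simp only: sums_def)
  have "((\<lambda>s. 1 / pi * (\<Sum>j. f j s)) has_integral (1 / pi * I)) {0..pi / 2}"
    by (intro has_integral_mult_right I)
  then have "((\<lambda>s. (leg_phi s)\<^sup>2 / sin s) has_integral (1 / pi * I)) {0..pi / 2}"
  proof (rule has_integral_eq[rotated])
    fix s assume "s \<in> {0..pi / 2}"
    then have "(\<lambda>j. f j s) sums (pi * ((leg_phi s)\<^sup>2 / sin s))"
      unfolding f_def by (intro leg_phi_series) auto
    then show "1 / pi * (\<Sum>j. f j s) = (leg_phi s)\<^sup>2 / sin s"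
      by (simp flip: sums_unique)
  qed
  moreover have "U sums (pi * (1 / pi * I))" using sums by simp
  ultimately show ?thesis using that unfolding U_def by blast
qed

text \<open>Parseval's identity for the Legendre expansion of \<open>1 / sqrt (1 - x\<^sup>2)\<close> against the inverse
  Legendre operator, after \<open>x = cos s\<close>.\<close>

lemma series_term_sums_integral:
  obtains I where "((\<lambda>s. (leg_phi s)\<^sup>2 / sin s) has_integral I) {0..pi / 2}"
    and "(\<lambda>n. series_term (Suc n)) sums I"
proof -
  from leg_phi_square_integral obtain I where
    I: "((\<lambda>s. (leg_phi s)\<^sup>2 / sin s) has_integral I) {0..pi / 2}"
    and U: "(\<lambda>j. cbin j / (2 * real j + 1) * (\<Sum>i=1..j. (cbin i - 1 / (2 * real i + 1)) / real i)) sums (pi * I)"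
    by blast
  define w where "w n = (4 * real n + 1) / (2 * real n * (2 * real n + 1)) * (cbin n)\<^sup>2" for n
  have w0: "w n \<ge> 0" for n by (simp add: w_def)
  \<comment> \<open>Division by zero gives this value, so sums may start at n = 0 without changing
    the series.\<close>
  have [simp]: "w 0 = 0" by (simp add: w_def)
  have term_eq: "series_term n = w n * (cbin n)\<^sup>2" for n
  proof -
    have "(2::real) ^ (8 * n) = (4 ^ n) ^ 4"
    proof -
      have "(4::real) = 2 ^ 2" by simp
      then show ?thesis by (simp only: power_mult[symmetric]) (simp add: mult_ac)
    qed
    then show ?thesis
      by (simp add: series_term_def w_def cbin_def power_divide power4_eq_xxxx power2_eq_square mult_ac)
  qed
  have "(\<lambda>n. w n * (pi * (cbin n)\<^sup>2)) sums (pi * I)"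
  \<comment> \<open>For fixed n, summing over j creates the second factor
    \<open>(cbin n)\<^sup>2\<close>; for fixed j, summing over n gives the weighted moment sum,
    whose series in j is already known to be \<open>pi * I\<close>.\<close>
  proof (rule sums_triangular_swap[where f = "\<lambda>n j. w n * (cbin j * leg_moment j n)"])
    show "w n * (cbin j * leg_moment j n) \<ge> 0" for n j
      using w0 cbin_pos leg_moment_nonneg by (simp add: less_imp_le)
    show "w n * (cbin j * leg_moment j n) = 0" if "j < n" for n j
      using that by (simp add: leg_moment_eq_0)
    show "(\<lambda>j. w n * (cbin j * leg_moment j n)) sums (w n * (pi * (cbin n)\<^sup>2))" for n
      using arcsin_series[of 1] by (intro sums_mult leg_moment_series) simp
    have "(\<Sum>n\<le>j. w n * (cbin j * leg_moment j n)) =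
        cbin j / (2 * real j + 1) * (\<Sum>i=1..j. (cbin i - 1 / (2 * real i + 1)) / real i)" for j
    proof -
      have "(\<Sum>n\<le>j. w n * (cbin j * leg_moment j n)) = (\<Sum>n=1..j. w n * (cbin j * leg_moment j n))"
        by (rule sum.mono_neutral_right) (auto simp: Suc_le_eq)
      also have "\<dots> = cbin j * (\<Sum>n=1..j. w n * leg_moment j n)"
        by (simp add: sum_distrib_left mult_ac)
      also have "\<dots> = cbin j / (2 * real j + 1) * ((2 * real j + 1) * (\<Sum>n=1..j. w n * leg_moment j n))"
        by (simp add: add_eq_0_iff)
      finally show ?thesis unfolding w_def leg_moment_weighted_sum .
    qed
    with U show "(\<lambda>j. \<Sum>n\<le>j. w n * (cbin j * leg_moment j n)) sums (pi * I)" by simp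
  qed
  from sums_mult[OF this, of "1 / pi"] have "(\<lambda>n. w n * (cbin n)\<^sup>2) sums I"
    by (simp add: mult_ac)
  moreover have "series_term = (\<lambda>n. w n * (cbin n)\<^sup>2)"
    by (rule ext) (rule term_eq)
  ultimately have "series_term sums I" by simp
  then have "(\<lambda>n. series_term (Suc n)) sums (I - series_term 0)"
    by (simp add: sums_Suc_iff)
  with I that show ?thesis by (simp add: term_eq)
qed

section \<open>Evaluation of the integral\<close>

text \<open>Integration by parts gains a factor 1/(2N). The derivative is required only in the open
  interval because the function of the application is a quotient 0/0 at the left end.\<close>

lemma riemann_lebesgue_cos:
  fixes g g' :: "real \<Rightarrow> real"
  assumes "a \<le> b" and cont: "continuous_on {a..b} g"
    and der: "\<And>x. x \<in> {a<..<b} \<Longrightarrow> (g has_field_derivative g' x) (at x)"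
    and bound: "\<And>x. x \<in> {a..b} \<Longrightarrow> \<bar>g' x\<bar> \<le> C"
  shows "(\<lambda>N. integral {a..b} (\<lambda>x. g x * cos (2 * real N * x))) \<longlonglongrightarrow> 0"
proof (rule Lim_null_comparison)
  define K where "K = C * (b - a) + \<bar>g a\<bar> + \<bar>g b\<bar>"
  show "(\<lambda>N. K * (1 / real N)) \<longlonglongrightarrow> 0"
    using tendsto_mult_left[OF lim_1_over_n, of K] by simp
  have "norm (integral {a..b} (\<lambda>x. g x * cos (2 * real N * x))) \<le> K * (1 / real N)" if N: "N > 0" for N
  proof -
    define c where "c = 2 * real N"
    have c: "c > 0" using N by (simp add: c_def)
    have C: "C \<ge> 0" using bound[of a] \<open>a \<le> b\<close> by auto
    define I where "I = integral {a..b} (\<lambda>x. g x * cos (c * x))"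
    have I: "((\<lambda>x. g x * cos (c * x)) has_integral I) {a..b}"
      unfolding I_def by (intro integrable_integral integrable_continuous_real continuous_intros cont)
    have "((\<lambda>x. g' x * sin (c * x) / c + g x * cos (c * x)) has_integral
        (g b * sin (c * b) / c - g a * sin (c * a) / c)) {a..b}"
    proof (rule fundamental_theorem_of_calculus_interior[OF \<open>a \<le> b\<close>])
      show "continuous_on {a..b} (\<lambda>x. g x * sin (c * x) / c)"
        using c by (intro continuous_intros cont) auto
      fix x assume "x \<in> {a<..<b}"
      then have "((\<lambda>x. g x * sin (c * x) / c) has_field_derivative
          g' x * sin (c * x) / c + g x * cos (c * x)) (at x)"
        using c by (auto intro!: derivative_eq_intros der simp: field_simps)
      then show "((\<lambda>x. g x * sin (c * x) / c) has_vector_derivative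
          g' x * sin (c * x) / c + g x * cos (c * x)) (at x)"
        by (simp add: has_real_derivative_iff_has_vector_derivative)
    qed
    \<comment> \<open>Integrability of the term with \<open>g'\<close> is inherited, as a difference
      of two integrable functions.\<close>
    from has_integral_diff[OF this I]
    have J: "((\<lambda>x. g' x * sin (c * x) / c) has_integral
        (g b * sin (c * b) / c - g a * sin (c * a) / c - I)) (cbox a b)" by simp
    have "norm (g b * sin (c * b) / c - g a * sin (c * a) / c - I) \<le> C / c * measure lborel (cbox a b)"
    proof (rule has_integral_bound[OF _ J])
      show "0 \<le> C / c" using C c by simp
      fix x assume "x \<in> cbox a b"
      then have "\<bar>g' x\<bar> * \<bar>sin (c * x)\<bar> \<le> C * 1"
        using bound[of x] C by (intro mult_mono) auto
      then show "norm (g' x * sin (c * x) / c) \<le> C / c"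
        using c by (simp add: abs_mult divide_right_mono)
    qed
    then have 1: "\<bar>g b * sin (c * b) / c - g a * sin (c * a) / c - I\<bar> \<le> C * (b - a) / c"
      using \<open>a \<le> b\<close> by simp
    have 2: "\<bar>g t * sin (c * t) / c\<bar> \<le> \<bar>g t\<bar> / c" for t
    proof -
      have "\<bar>g t\<bar> * \<bar>sin (c * t)\<bar> \<le> \<bar>g t\<bar> * 1" by (intro mult_left_mono) auto
      then show ?thesis using c by (simp add: abs_mult divide_right_mono)
    qed
    have "\<bar>I\<bar> \<le> C * (b - a) / c + \<bar>g a\<bar> / c + \<bar>g b\<bar> / c"
      using 1 2[of a] 2[of b] by linarith
    also have "\<dots> = K * (1 / c)" by (simp add: K_def add_divide_distrib)
    also have "\<dots> \<le> K * (1 / real N)"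
    proof (rule mult_left_mono)
      show "1 / c \<le> 1 / real N" using N by (simp add: c_def field_simps)
      have "0 \<le> C * (b - a)" using C \<open>a \<le> b\<close> by simp
      then show "0 \<le> K" by (simp add: K_def)
    qed
    finally show ?thesis by (simp add: I_def c_def)
  qed
  then show "\<forall>\<^sub>F N in sequentially. norm (integral {a..b} (\<lambda>x. g x * cos (2 * real N * x))) \<le> K * (1 / real N)"
    by (rule eventually_mono[OF eventually_gt_at_top[of 0]])
qed

text \<open>The products telescope, as 2 sin s sin((2k+1)s) = cos(2ks) - cos((2k+2)s). This is the
  expansion of 1/sin s with an exact remainder.\<close>

lemma dirichlet_sin_sum:
  "2 * sin s * (\<Sum>k<N. sin ((2 * real k + 1) * s)) = 1 - cos (2 * real N * s)"
proof (induction N)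
  case (Suc N)
  define x where "x = (2 * real N + 1) * s"
  have "2 * sin s * (\<Sum>k<Suc N. sin ((2 * real k + 1) * s))
      = 1 - cos (2 * real N * s) + 2 * sin s * sin x"
    by (simp only: sum.lessThan_Suc distrib_left Suc.IH x_def)
  also have "2 * real N * s = x - s" by (simp add: x_def algebra_simps)
  also have "1 - cos (x - s) + 2 * sin s * sin x = 1 - cos (x + s)"
    by (simp add: cos_add cos_diff)
  also have "x + s = 2 * real (Suc N) * s" by (simp add: x_def algebra_simps)
  finally show ?case .
qed simp

text \<open>Cancelling 1 - cos s gives sin s (1 - cos s)/(1 + cos s), with antiderivative cos s - 2
  ln(1 + cos s). At s = 0 both forms are 0, the original one by division by zero.\<close>

lemma has_integral_square_one_minus_cos_over_sin:
  "((\<lambda>s. (1 - cos s)\<^sup>2 / sin s) has_integral (2 * ln 2 - 1)) {0..pi / 2}"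
proof -
  have "((\<lambda>s. (1 - cos s)\<^sup>2 / sin s) has_integral
     ((cos (pi / 2) - 2 * ln (1 + cos (pi / 2))) - (cos 0 - 2 * ln (1 + cos 0)))) {0..pi / 2}"
  proof (rule fundamental_theorem_of_calculus)
    fix s :: real assume s: "s \<in> {0..pi / 2}"
    then have c: "cos s \<ge> 0" by (intro cos_ge_zero) auto
    have "((\<lambda>s. cos s - 2 * ln (1 + cos s)) has_field_derivative
        - sin s - 2 * (- sin s / (1 + cos s))) (at s within {0..pi / 2})"
      using c by (auto intro!: derivative_eq_intros simp: add_pos_nonneg)
    also have "- sin s - 2 * (- sin s / (1 + cos s)) = sin s * (1 - cos s) / (1 + cos s)"
      using c by (simp add: divide_simps add_eq_0_iff) (simp add: algebra_simps)
    also have "\<dots> = (1 - cos s)\<^sup>2 / sin s"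
    proof (cases "sin s = 0")
      case False
      have "sin s * sin s = (1 - cos s) * (1 + cos s)"
        using sin_squared_eq[of s] by (simp add: power2_eq_square algebra_simps)
      with False c show ?thesis
        by (simp add: frac_eq_eq add_eq_0_iff power2_eq_square)
    qed simp
    finally show "((\<lambda>s. cos s - 2 * ln (1 + cos s)) has_vector_derivative (1 - cos s)\<^sup>2 / sin s)
        (at s within {0..pi / 2})"
      by (simp add: has_real_derivative_iff_has_vector_derivative)
  qed simp
  then show ?thesis by simp
qed

text \<open>The square and cross terms in the expansion of the square of \<open>leg_phi\<close>,
  left after splitting off \<open>(1 - cos s)\<^sup>2\<close>, whose quotient by sine integrates
  elementarily.\<close>

definition leg_psi :: "real \<Rightarrow> real" where
  "leg_psi s = 4 / pi\<^sup>2 * s\<^sup>2 - 4 / pi * (s * (1 - cos s))"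

lemma leg_phi_square: "(leg_phi s)\<^sup>2 = (1 - cos s)\<^sup>2 + leg_psi s"
  unfolding leg_phi_def leg_psi_def by (simp add: power2_eq_square field_simps)

lemma four_over_pi_bounds: "4 / pi \<le> 2" "4 / pi\<^sup>2 \<le> 1"
proof -
  have "9 \<le> pi\<^sup>2" using power_mono[of 3 pi 2] pi_gt3 by simp
  then show "4 / pi\<^sup>2 \<le> 1" by (simp add: divide_le_eq)
  show "4 / pi \<le> 2" using pi_gt3 by (simp add: divide_le_eq)
qed

text \<open>Each of the two terms is at most 4 sin^2 s. This quadratic vanishing at 0 makes the
  quotient by sine continuous with bounded derivative.\<close>

lemma abs_leg_psi_le:
  assumes "0 \<le> s" "s \<le> pi / 2"
  shows "\<bar>leg_psi s\<bar> \<le> 8 * (sin s)\<^sup>2"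
proof -
  have s: "0 \<le> sin s" using assms by (intro sin_ge_zero) auto
  have "s\<^sup>2 \<le> (2 * sin s)\<^sup>2" using le_two_sin[OF assms] assms by (intro power_mono) auto
  then have 1: "s\<^sup>2 \<le> 4 * (sin s)\<^sup>2" by (simp add: power_mult_distrib)
  have "s * (1 - cos s) \<le> (2 * sin s) * sin s"
    using le_two_sin[OF assms] one_minus_cos_le_sin[OF assms] assms s by (intro mult_mono) auto
  then have 2: "s * (1 - cos s) \<le> 2 * (sin s)\<^sup>2" by (simp add: power2_eq_square)
  have "4 / pi\<^sup>2 * s\<^sup>2 \<le> 1 * (4 * (sin s)\<^sup>2)"
    using 1 four_over_pi_bounds by (intro mult_mono) auto
  moreover have "4 / pi * (s * (1 - cos s)) \<le> 2 * (2 * (sin s)\<^sup>2)"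
    using 2 four_over_pi_bounds assms by - (rule mult_mono, auto)
  moreover have "0 \<le> 4 / pi\<^sup>2 * s\<^sup>2" "0 \<le> 4 / pi * (s * (1 - cos s))" using assms by auto
  moreover have "\<bar>x - y\<bar> \<le> 8 * z" if "x \<le> 1 * (4 * z)" "y \<le> 2 * (2 * z)" "0 \<le> x" "0 \<le> y" for x y z :: real
    using that by linarith
  ultimately show ?thesis unfolding leg_psi_def by blast
qed

lemma leg_psi_over_sin_remainder:
  "(\<lambda>N. integral {0..pi / 2} (\<lambda>s. leg_psi s / sin s * cos (2 * real N * s))) \<longlonglongrightarrow> 0"
proof -
  define d where "d s = 4 / pi\<^sup>2 * (2 * s) - 4 / pi * (1 - cos s + s * sin s)" for s :: real
  have der: "((\<lambda>s. leg_psi s / sin s) has_field_derivative (d s * sin s - leg_psi s * cos s) / (sin s)\<^sup>2) (at s)"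
    if "sin s \<noteq> 0" for s
  proof -
    have "(leg_psi has_field_derivative d s) (at s)"
    proof -
      have "((\<lambda>s. p * s\<^sup>2 - q * (s * (1 - cos s))) has_field_derivative
          p * (2 * s) - q * (1 - cos s + s * sin s)) (at s)" for p q :: real
        by (auto intro!: derivative_eq_intros simp: algebra_simps)
      then show ?thesis unfolding leg_psi_def d_def .
    qed
    from DERIV_divide[OF this DERIV_sin that] show ?thesis
      by (simp add: power2_eq_square)
  qed
  have pos: "sin s > 0" if "s \<in> {0<..pi / 2}" for s
    using that by (intro sin_gt_zero) auto
  show ?thesis
  \<comment> \<open>In the quotient rule the numerator is at most (10 + 8) sin^2 s: 10 from the
    bound \<open>10 * sin s\<close> on \<open>d s\<close>, and 8 from the bound on
    \<open>leg_psi\<close>.\<close>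
  proof (rule riemann_lebesgue_cos[where C = 18])
    show "((\<lambda>s. leg_psi s / sin s) has_field_derivative (d s * sin s - leg_psi s * cos s) / (sin s)\<^sup>2) (at s)"
      if "s \<in> {0<..<pi / 2}" for s
      using that pos[of s] by (intro der) auto
    show "continuous_on {0..pi / 2} (\<lambda>s. leg_psi s / sin s)"
      unfolding continuous_on_eq_continuous_within
    proof
      fix s assume s: "s \<in> {0..pi / 2}"
      show "continuous (at s within {0..pi / 2}) (\<lambda>s. leg_psi s / sin s)"
      proof (cases "s = 0")
        case False
        with s pos[of s] have "isCont (\<lambda>s. leg_psi s / sin s) s"
          by (intro DERIV_isCont[OF der]) auto
        then show ?thesis by (rule continuous_at_imp_continuous_at_within)
      next
        case True
        \<comment> \<open>The default value of the quotient at 0 agrees with its limit.\<close>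
        have "((\<lambda>s. leg_psi s / sin s) \<longlongrightarrow> 0) (at 0 within {0..pi / 2})"
        proof (rule Lim_null_comparison)
          have "((\<lambda>s. 8 * sin s) \<longlongrightarrow> 8 * sin 0) (at (0::real) within {0..pi / 2})"
            by (intro tendsto_intros)
          then show "((\<lambda>s. 8 * sin s) \<longlongrightarrow> 0) (at (0::real) within {0..pi / 2})" by simp
          have "norm (leg_psi t / sin t) \<le> 8 * sin t" if t: "t \<in> {0..pi / 2}" for t
          proof (cases "sin t = 0")
            case False
            have "0 \<le> sin t" using t by (intro sin_ge_zero) auto
            with False abs_leg_psi_le[of t] t show ?thesis
              by (simp add: divide_le_eq power2_eq_square mult.assoc)
          qed simp
          then show "\<forall>\<^sub>F t in at 0 within {0..pi / 2}. norm (leg_psi t / sin t) \<le> 8 * sin t"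
            by (auto simp: eventually_at_filter)
        qed
        with True show ?thesis by (simp add: continuous_within)
      qed
    qed
    fix s assume s: "s \<in> {0..pi / 2}"
    show "\<bar>(d s * sin s - leg_psi s * cos s) / (sin s)\<^sup>2\<bar> \<le> 18"
    proof (cases "sin s = 0")
      case False
      have s0: "0 \<le> sin s" using s by (intro sin_ge_zero) auto
      with False have s1: "0 < sin s" by simp
      have le: "s \<le> 2 * sin s" "1 - cos s \<le> sin s"
        using s le_two_sin[of s] one_minus_cos_le_sin[of s] by auto
      have "s * sin s \<le> 2 * sin s * 1"
        using le s s0 by (intro mult_mono) auto
      then have "1 - cos s + s * sin s \<le> 3 * sin s" using le by simp
      then have "4 / pi * (1 - cos s + s * sin s) \<le> 2 * (3 * sin s)"
        using s s0 four_over_pi_bounds by (intro mult_mono) auto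
      moreover have "4 / pi\<^sup>2 * (2 * s) \<le> 1 * (4 * sin s)"
        using s s0 le four_over_pi_bounds by - (rule mult_mono, auto)
      moreover have "0 \<le> 4 / pi * (1 - cos s + s * sin s)" "0 \<le> 4 / pi\<^sup>2 * (2 * s)"
        using s s0 by auto
      moreover have "\<bar>x - y\<bar> \<le> 10 * z" if "y \<le> 2 * (3 * z)" "x \<le> 1 * (4 * z)" "0 \<le> y" "0 \<le> x" for x y z :: real
        using that by linarith
      ultimately have "\<bar>d s\<bar> \<le> 10 * sin s"
        unfolding d_def by blast
      then have "\<bar>d s * sin s\<bar> \<le> 10 * sin s * sin s"
        unfolding abs_mult using s0 by (intro mult_mono) auto
      moreover have "\<bar>leg_psi s * cos s\<bar> \<le> 8 * (sin s)\<^sup>2 * 1"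
        unfolding abs_mult using s abs_leg_psi_le[of s] by (intro mult_mono) auto
      ultimately have "\<bar>d s * sin s - leg_psi s * cos s\<bar> \<le> 18 * (sin s)\<^sup>2"
        by (simp add: power2_eq_square abs_le_iff)
      with s1 show ?thesis by (simp add: divide_le_eq)
    qed simp
  qed simp
qed

section \<open>Sine moments of s and of its square\<close>

lemma has_integral_x_sin:
  fixes a b :: real
  assumes "a \<noteq> 0" "0 \<le> b"
  shows "((\<lambda>s. s * sin (a * s)) has_integral (sin (a * b) / a\<^sup>2 - b * cos (a * b) / a)) {0..b}"
proof -
  have "((\<lambda>s. s * sin (a * s)) has_integral
      ((sin (a * b) / a\<^sup>2 - b * cos (a * b) / a) - (sin (a * 0) / a\<^sup>2 - 0 * cos (a * 0) / a))) {0..b}"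
  proof (rule fundamental_theorem_of_calculus[OF assms(2)])
    fix s
    have "((\<lambda>s. sin (a * s) / a\<^sup>2 - s * cos (a * s) / a) has_field_derivative s * sin (a * s)) (at s within {0..b})"
      using assms by (auto intro!: derivative_eq_intros simp: field_simps power2_eq_square)
    then show "((\<lambda>s. sin (a * s) / a\<^sup>2 - s * cos (a * s) / a) has_vector_derivative s * sin (a * s)) (at s within {0..b})"
      by (simp add: has_real_derivative_iff_has_vector_derivative)
  qed
  then show ?thesis by simp
qed

lemma has_integral_x_square_sin:
  fixes a b :: real
  assumes "a \<noteq> 0" "0 \<le> b"
  shows "((\<lambda>s. s\<^sup>2 * sin (a * s)) has_integral
     (2 * b * sin (a * b) / a\<^sup>2 + (2 / a ^ 3 - b\<^sup>2 / a) * cos (a * b) - 2 / a ^ 3)) {0..b}"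
proof -
  define F where "F s = 2 * s * sin (a * s) / a\<^sup>2 + (2 / a ^ 3 - s\<^sup>2 / a) * cos (a * s)" for s
  have "((\<lambda>s. s\<^sup>2 * sin (a * s)) has_integral (F b - F 0)) {0..b}"
  proof (rule fundamental_theorem_of_calculus[OF assms(2)])
    fix s
    have "((\<lambda>s. 2 * s * sin (a * s) / p + (q - s\<^sup>2 / a) * cos (a * s)) has_field_derivative
        (2 * sin (a * s) + 2 * s * (cos (a * s) * a)) / p
         + (- (2 * s) / a * cos (a * s) + (q - s\<^sup>2 / a) * (- sin (a * s) * a))) (at s within {0..b})"
      if "p \<noteq> 0" for p q
      using assms that by (auto intro!: derivative_eq_intros simp: field_simps)
    from this[of "a\<^sup>2" "2 / a ^ 3"] assms have "(F has_field_derivative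
        (2 * sin (a * s) + 2 * s * (cos (a * s) * a)) / a\<^sup>2
         + (- (2 * s) / a * cos (a * s) + (2 / a ^ 3 - s\<^sup>2 / a) * (- sin (a * s) * a))) (at s within {0..b})"
      by (simp add: F_def[abs_def])
    also have "(2 * sin (a * s) + 2 * s * (cos (a * s) * a)) / a\<^sup>2
         + (- (2 * s) / a * cos (a * s) + (2 / a ^ 3 - s\<^sup>2 / a) * (- sin (a * s) * a)) = s\<^sup>2 * sin (a * s)"
      using assms by (simp add: power2_eq_square power3_eq_cube divide_simps) (simp add: algebra_simps)
    finally show "(F has_vector_derivative s\<^sup>2 * sin (a * s)) (at s within {0..b})"
      by (simp add: has_real_derivative_iff_has_vector_derivative)
  qed
  then show ?thesis by (simp add: F_def)
qed

lemma has_integral_x_sin_even: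
  "((\<lambda>s. s * sin (2 * real p * s)) has_integral (- (pi * (- 1) ^ p / (4 * real p)))) {0..pi / 2}"
proof (cases "p = 0")
  case False
  have "2 * real p * (pi / 2) = real p * pi" by simp
  with has_integral_x_sin[of "2 * real p" "pi / 2"] False show ?thesis
    by (simp add: cos_npi sin_npi mult_ac)
qed simp

text \<open>For \<open>k = 0\<close> the term \<open>1 / real k\<close> is \<open>0\<close>, which is the correct value here.\<close>

lemma leg_psi_sin_coeff:
  "((\<lambda>s. 2 * leg_psi s * sin ((2 * real k + 1) * s)) has_integral
     ((- 1) ^ k / real (Suc k) - (- 1) ^ k / real k - 16 / pi\<^sup>2 * (1 / (2 * real k + 1) ^ 3))) {0..pi / 2}"
proof -
  define m where "m = 2 * real k + 1"
  have m: "m \<noteq> 0" by (simp add: m_def add_eq_0_iff)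
  have mpi: "m * (pi / 2) = real k * pi + pi / 2" by (simp add: m_def field_simps)
  have trig: "sin (m * (pi / 2)) = (- 1) ^ k" "cos (m * (pi / 2)) = 0"
    unfolding mpi by (simp_all add: sin_add cos_add cos_npi sin_npi)
  have 1: "((\<lambda>s. s\<^sup>2 * sin (m * s)) has_integral (pi * (- 1) ^ k / m\<^sup>2 - 2 / m ^ 3)) {0..pi / 2}"
    using has_integral_x_square_sin[OF m, of "pi / 2"] unfolding trig by simp
  have 2: "((\<lambda>s. s * sin (m * s)) has_integral ((- 1) ^ k / m\<^sup>2)) {0..pi / 2}"
    using has_integral_x_sin[OF m, of "pi / 2"] unfolding trig by simp
  \<comment> \<open>The product sin(ms) cos s is split into sines of (2k+2)s and 2ks, leaving only
    moments already computed.\<close>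
  have "((\<lambda>s. 8 / pi\<^sup>2 * (s\<^sup>2 * sin (m * s)) - 8 / pi * (s * sin (m * s))
      + 4 / pi * (s * sin (2 * real (Suc k) * s) + s * sin (2 * real k * s))) has_integral
     (8 / pi\<^sup>2 * (pi * (- 1) ^ k / m\<^sup>2 - 2 / m ^ 3) - 8 / pi * ((- 1) ^ k / m\<^sup>2)
      + 4 / pi * (- (pi * (- 1) ^ Suc k / (4 * real (Suc k))) + - (pi * (- 1) ^ k / (4 * real k))))) {0..pi / 2}"
    by (intro has_integral_add has_integral_diff has_integral_mult_right 1 2 has_integral_x_sin_even)
  moreover have "8 / pi\<^sup>2 * (s\<^sup>2 * sin (m * s)) - 8 / pi * (s * sin (m * s))
      + 4 / pi * (s * sin (2 * real (Suc k) * s) + s * sin (2 * real k * s))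
      = 2 * leg_psi s * sin (m * s)" for s
  proof -
    have e: "2 * real (Suc k) * s = m * s + s" "2 * real k * s = m * s - s"
      by (simp_all add: m_def algebra_simps)
    have "sin (2 * real (Suc k) * s) + sin (2 * real k * s) = 2 * sin (m * s) * cos s"
      unfolding e by (simp add: sin_add sin_diff)
    then have "s * sin (2 * real (Suc k) * s) + s * sin (2 * real k * s) = s * (2 * sin (m * s) * cos s)"
      by (metis distrib_left)
    moreover have "2 * p * (s\<^sup>2 * x) - 2 * q * (s * x) + q * (s * (2 * x * cos s))
        = 2 * (p * s\<^sup>2 - q * (s * (1 - cos s))) * x" for p q x
      by algebra
    from this[of "4 / pi\<^sup>2" "sin (m * s)" "4 / pi"] have
      "8 / pi\<^sup>2 * (s\<^sup>2 * sin (m * s)) - 8 / pi * (s * sin (m * s)) + 4 / pi * (s * (2 * sin (m * s) * cos s))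
        = 2 * leg_psi s * sin (m * s)"
      unfolding leg_psi_def by simp
    ultimately show ?thesis by (simp only:)
  qed
  moreover have "8 / pi\<^sup>2 * (pi * (- 1) ^ k / m\<^sup>2 - 2 / m ^ 3) - 8 / pi * ((- 1) ^ k / m\<^sup>2)
      + 4 / pi * (- (pi * (- 1) ^ Suc k / (4 * real (Suc k))) + - (pi * (- 1) ^ k / (4 * real k)))
    = (- 1) ^ k / real (Suc k) - (- 1) ^ k / real k - 16 / pi\<^sup>2 * (1 / m ^ 3)"
  proof -
    \<comment> \<open>The terms in (-1)^k/m^2, whose sum over k would be Catalan's constant, cancel
      here.\<close>
    have a: "8 / pi\<^sup>2 * (pi * x / m\<^sup>2 - 2 / m ^ 3) - 8 / pi * (x / m\<^sup>2) = - (16 / pi\<^sup>2 * (1 / m ^ 3))" for x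
      by (simp add: right_diff_distrib power2_eq_square)
    have b: "4 / pi * (- (pi * (- 1) ^ Suc k / (4 * real (Suc k))) + - (pi * (- 1) ^ k / (4 * real k)))
       = (- 1) ^ k / real (Suc k) - (- 1) ^ k / real k"
      by (simp add: distrib_left right_diff_distrib del: of_nat_Suc)
    show ?thesis unfolding a b by simp
  qed
  ultimately show ?thesis by (simp only: m_def)
qed

section \<open>Summation of the coefficients\<close>

text \<open>After grouping in pairs, the even denominators contribute one eighth of the whole
  series.\<close>

lemma odd_zeta_3_sums: "(\<lambda>k. 1 / (2 * real k + 1) ^ 3) sums (7 / 8 * zeta_real 3)"
proof -
  have z: "(\<lambda>k. 1 / real (Suc k) ^ 3) sums zeta_real 3"
    using zeta_real_sums[of 3] by (simp add: powr_numeral del: of_nat_Suc)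
  have "(\<lambda>n. sum (\<lambda>k. 1 / real (Suc k) ^ 3) {n * 2..<n * 2 + 2}) sums zeta_real 3"
    by (rule sums_group[OF z]) simp
  moreover have "sum (\<lambda>k. 1 / real (Suc k) ^ 3) {n * 2..<n * 2 + 2}
      = 1 / (2 * real n + 1) ^ 3 + 1 / 8 * (1 / real (Suc n) ^ 3)" for n
  proof -
    have "{n * 2..<n * 2 + 2} = {2 * n, 2 * n + 1}" by auto
    moreover have "real (Suc (2 * n + 1)) ^ 3 = 8 * real (Suc n) ^ 3"
      by (simp add: power3_eq_cube algebra_simps)
    ultimately show ?thesis by (simp add: add_ac)
  qed
  ultimately have "(\<lambda>n. 1 / (2 * real n + 1) ^ 3 + 1 / 8 * (1 / real (Suc n) ^ 3)) sums zeta_real 3"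
    by (simp only:)
  from sums_diff[OF this sums_mult[OF z, of "1 / 8"]] show ?thesis by simp
qed

text \<open>The two alternating series have sums ln 2 and -ln 2, the second because its k = 0 term
  is 0; moreover 16 times 7/8 is 14.\<close>

lemma leg_psi_sin_coeff_sums:
  "(\<lambda>k. (- 1) ^ k / real (Suc k) - (- 1) ^ k / real k - 16 / pi\<^sup>2 * (1 / (2 * real k + 1) ^ 3))
     sums (2 * ln 2 - 14 * zeta_real 3 / pi\<^sup>2)"
proof -
  have "(\<lambda>k. (- 1) ^ Suc k / real (Suc k)) sums (- ln 2)"
    using sums_minus[OF alternating_harmonic_series_sums] by simp
  then have "(\<lambda>k. (- 1) ^ k / real k) sums (- ln 2)"
    by (subst (asm) sums_Suc_iff) simp
  from sums_diff[OF sums_diff[OF alternating_harmonic_series_sums this] sums_mult[OF odd_zeta_3_sums, of "16 / pi\<^sup>2"]]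
  show ?thesis by simp
qed

text \<open>The sine expansion is cut at N with exact remainder
  \<open>leg_psi s / sin s * cos (2 * real N * s)\<close>, whose integral tends to 0. Hence J is the
  limit of the coefficient sums, with no termwise integration of an infinite series.\<close>

lemma has_integral_leg_psi_over_sin:
  assumes "((\<lambda>s. leg_psi s / sin s) has_integral J) {0..pi / 2}"
  shows "J = 2 * ln 2 - 14 * zeta_real 3 / pi\<^sup>2"
proof -
  define e where "e k = (- 1) ^ k / real (Suc k) - (- 1) ^ k / real k - 16 / pi\<^sup>2 * (1 / (2 * real k + 1) ^ 3)" for k
  have "integral {0..pi / 2} (\<lambda>s. leg_psi s / sin s * cos (2 * real N * s)) = J - (\<Sum>k<N. e k)" for N
  proof (rule integral_unique)
    have "((\<lambda>s. leg_psi s / sin s - (\<Sum>k<N. 2 * leg_psi s * sin ((2 * real k + 1) * s))) has_integral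
        (J - (\<Sum>k<N. e k))) {0..pi / 2}"
      unfolding e_def by (intro has_integral_diff assms has_integral_sum leg_psi_sin_coeff) simp
    then show "((\<lambda>s. leg_psi s / sin s * cos (2 * real N * s)) has_integral (J - (\<Sum>k<N. e k))) {0..pi / 2}"
    proof (rule has_integral_eq[rotated])
      fix s assume s: "s \<in> {0..pi / 2}"
      show "leg_psi s / sin s - (\<Sum>k<N. 2 * leg_psi s * sin ((2 * real k + 1) * s))
          = leg_psi s / sin s * cos (2 * real N * s)"
      proof (cases "sin s = 0")
        case True
        then have "leg_psi s = 0" using abs_leg_psi_le[of s] s by auto
        then show ?thesis by simp
      next
        case False
        have "(\<Sum>k<N. 2 * leg_psi s * sin ((2 * real k + 1) * s))
            = leg_psi s / sin s * (2 * sin s * (\<Sum>k<N. sin ((2 * real k + 1) * s)))"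
          using False by (simp add: sum_distrib_left mult_ac)
        also have "\<dots> = leg_psi s / sin s * (1 - cos (2 * real N * s))"
          by (simp only: dirichlet_sin_sum)
        finally show ?thesis by (simp add: right_diff_distrib)
      qed
    qed
  qed
  with leg_psi_over_sin_remainder have "(\<lambda>N. J - (\<Sum>k<N. e k)) \<longlonglongrightarrow> 0" by simp
  from tendsto_diff[OF tendsto_const[of J] this] have "(\<lambda>N. \<Sum>k<N. e k) \<longlonglongrightarrow> J" by simp
  moreover have "(\<lambda>N. \<Sum>k<N. e k) \<longlonglongrightarrow> 2 * ln 2 - 14 * zeta_real 3 / pi\<^sup>2"
    using leg_psi_sin_coeff_sums unfolding e_def sums_def .
  ultimately show ?thesis by (rule LIMSEQ_unique)
qed

theorem theorem3p1:
  shows "summable (\<lambda>n. series_term (Suc n)) \<and>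
    - (14 * zeta_real 3 / pi ^ 2) + 4 * ln 2 = 1 + (\<Sum>n. series_term (Suc n))"
proof -
  obtain I where I: "((\<lambda>s. (leg_phi s)\<^sup>2 / sin s) has_integral I) {0..pi / 2}"
    and sums: "(\<lambda>n. series_term (Suc n)) sums I"
    by (rule series_term_sums_integral)
  \<comment> \<open>Subtracting the elementary part leaves the quotient of \<open>leg_psi\<close> by
    sine and provides its integrability as well.\<close>
  have "((\<lambda>s. (leg_phi s)\<^sup>2 / sin s - (1 - cos s)\<^sup>2 / sin s) has_integral (I - (2 * ln 2 - 1))) {0..pi / 2}"
    by (intro has_integral_diff I has_integral_square_one_minus_cos_over_sin)
  then have "((\<lambda>s. leg_psi s / sin s) has_integral (I - (2 * ln 2 - 1))) {0..pi / 2}"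
    by (simp add: leg_phi_square add_divide_distrib)
  from has_integral_leg_psi_over_sin[OF this]
  have "I = 4 * ln 2 - 1 - 14 * zeta_real 3 / pi\<^sup>2" by simp
  with sums show ?thesis by (simp add: sums_iff)
qed

end
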